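(* Let $m,n\ge 2$ be integers. Then $t(m,n)=\left\lfloor\frac{mn}{2}\right\rfloor$.
   Context: The toroidal $m\times n$ board is obtained from the $m\times n$ rectangular board of unit squares by identifying opposite sides, so that rows are indexed cyclically modulo $m$ and columns cyclically modulo $n$. $\mathcal C$ is its set of $mn$ cells. Two distinct cells are neighbors if they share at least one point (a side or a corner) on the torus. The neighbors of a set $R\subseteq \mathcal C$ are the cells not in $R$ that have a neighbor in $R$. A height function is a map $h:\mathcal C\to\mathbb R$. A nonempty set $R\subseteq\mathcal C$ of an allowed shape is an island of $h$ if the minimum of $h$ on $R$ is strictly greater than the maximum of $h$ on the neighbors of $R$. The allowed shapes are: rectangles (all cells in a set of at most $m-1$ cyclically consecutive rows and a set of at most $n-1$ cyclically consecutive columns), and the whole torus, which (having no neighbors) always counts as an island. Sets that wrap completely around the torus in one direction, other than the whole torus, are not rectangles. $t(m,n)$ denotes the maximum, over all height functions $h$, of the number of islands of $h$. *)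

theory Defs
  imports Complex_Main
begin

type_synonym cell = "nat \<times> nat"

definition cells :: "nat \<Rightarrow> nat \<Rightarrow> cell set" where
  "cells m n = {..<m} \<times> {..<n}"

definition unit_square :: "cell \<Rightarrow> (real \<times> real) set" where
  "unit_square c = {real (fst c)..real (fst c) + 1} \<times> {real (snd c)..real (snd c) + 1}"

(* The torus is the plane modulo the lattice m Z x n Z; restricted to the board
   [0,m] x [0,n] this is the identification of opposite sides. *)
definition torus_eq :: "nat \<Rightarrow> nat \<Rightarrow> real \<times> real \<Rightarrow> real \<times> real \<Rightarrow> bool" where
  "torus_eq m n p q \<longleftrightarrow>
     (\<exists>a b :: int. fst p - fst q = of_int a * real m \<and> snd p - snd q = of_int b * real n)"

definition neighbor :: "nat \<Rightarrow> nat \<Rightarrow> cell \<Rightarrow> cell \<Rightarrow> bool" where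
  "neighbor m n c d \<longleftrightarrow>
     c \<noteq> d \<and> (\<exists>p\<in>unit_square c. \<exists>q\<in>unit_square d. torus_eq m n p q)"

definition neighbors :: "nat \<Rightarrow> nat \<Rightarrow> cell set \<Rightarrow> cell set" where
  "neighbors m n R = {c \<in> cells m n. c \<notin> R \<and> (\<exists>d\<in>R. neighbor m n c d)}"

definition cyclic_interval :: "nat \<Rightarrow> nat \<Rightarrow> nat \<Rightarrow> nat set" where
  "cyclic_interval m s k = (\<lambda>i. (s + i) mod m) ` {..<k}"

definition rectangle :: "nat \<Rightarrow> nat \<Rightarrow> cell set \<Rightarrow> bool" where
  "rectangle m n R \<longleftrightarrow>
     (\<exists>r k s l. r < m \<and> k \<le> m - 1 \<and> s < n \<and> l \<le> n - 1 \<and>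
        R = cyclic_interval m r k \<times> cyclic_interval n s l)"

(* The case of no neighbors is separate because Max {} is unspecified; for m, n >= 2
   it arises only for the whole torus. *)
definition island :: "nat \<Rightarrow> nat \<Rightarrow> (cell \<Rightarrow> real) \<Rightarrow> cell set \<Rightarrow> bool" where
  "island m n h R \<longleftrightarrow>
     R \<noteq> {} \<and> (rectangle m n R \<or> R = cells m n) \<and>
     (neighbors m n R = {} \<or> Min (h ` R) > Max (h ` neighbors m n R))"

definition islands :: "nat \<Rightarrow> nat \<Rightarrow> (cell \<Rightarrow> real) \<Rightarrow> cell set set" where
  "islands m n h = {R. island m n h R}"

(* Only the values of h on cells m n matter, so total functions may be used. *)
definition max_islands :: "nat \<Rightarrow> nat \<Rightarrow> nat" where
  "max_islands m n = Max (range (\<lambda>h :: cell \<Rightarrow> real. card (islands m n h)))"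

lemma island_subset_cells:
  assumes "island m n h R"
  shows "R \<subseteq> cells m n"
  using assms by (auto simp: island_def rectangle_def cyclic_interval_def cells_def)

lemma islands_subset_Pow: "islands m n h \<subseteq> Pow (cells m n)"
  by (simp add: islands_def subset_iff) (meson island_subset_cells subsetD)

lemma finite_Pow_cells: "finite (Pow (cells m n))"
  by (simp add: cells_def)

lemma finite_islands: "finite (islands m n h)"
  by (rule finite_subset[OF islands_subset_Pow finite_Pow_cells])

lemma finite_island_counts:
  "finite (range (\<lambda>h :: cell \<Rightarrow> real. card (islands m n h)))"
proof (rule finite_subset)
  show "range (\<lambda>h :: cell \<Rightarrow> real. card (islands m n h)) \<subseteq> {..card (Pow (cells m n))}"
    using card_mono[OF finite_Pow_cells islands_subset_Pow] by blast
qed simp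

lemma unit_interval_meet_iff:
  fixes i j m :: nat and a :: int
  shows "(\<exists>x\<in>{real i..real i + 1}. \<exists>y\<in>{real j..real j + 1}. x - y = of_int a * real m)
         \<longleftrightarrow> \<bar>int i - int j - a * int m\<bar> \<le> 1" (is "?L \<longleftrightarrow> ?R")
proof
  assume ?L
  then have "\<bar>real i - real j - of_int a * real m\<bar> \<le> 1" by auto
  then have "of_int \<bar>int i - int j - a * int m\<bar> \<le> (of_int 1 :: real)" by simp
  then show ?R by (simp only: of_int_le_iff)
next
  assume ?R
  then have "of_int \<bar>int i - int j - a * int m\<bar> \<le> (of_int 1 :: real)"
    by (simp only: of_int_le_iff)
  then have *: "\<bar>real i - real j - of_int a * real m\<bar> \<le> 1" by simp
  define y where "y = max (real j) (real i - of_int a * real m)"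
  have "y \<in> {real j..real j + 1}" "y + of_int a * real m \<in> {real i..real i + 1}"
    using * by (auto simp: y_def)
  then show ?L by (intro bexI[of _ "y + of_int a * real m"] bexI[of _ y]) auto
qed

lemma neighbor_iff:
  "neighbor m n c d \<longleftrightarrow> c \<noteq> d \<and>
     (\<exists>a::int. \<bar>int (fst c) - int (fst d) - a * int m\<bar> \<le> 1) \<and>
     (\<exists>b::int. \<bar>int (snd c) - int (snd d) - b * int n\<bar> \<le> 1)"
  unfolding neighbor_def torus_eq_def unit_square_def unit_interval_meet_iff[symmetric]
  by (simp add: Bex_def split_paired_Ex) blast

end

theory Submission
  imports Defs
begin

text \<open>
  Two cells are called close if they are equal or neighbors. A family of cell sets is laminar if
  any two members are nested or have no close cells between them. Both bounds go through this
  notion, because nonempty rectangles can be islands of one and the same height function if and only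
  if they form a laminar family:

  \<^item> The rectangular islands of a height function form a laminar family
  (\<open>islands_laminar\<close>). If two of them were close but not nested, each would contain a neighbor
  of the other, since rectangles are connected; then the minimum of each would be strictly greater
  than the minimum of the other.

  \<^item> Conversely, given a laminar family, let the height of a cell be the number of members that
  contain it. Every rectangle \<open>A\<close> in the family is then an island
  (\<open>laminar_depth_island\<close>): a member that contains a neighbor of \<open>A\<close> is close
  to \<open>A\<close> and not inside it, so it contains \<open>A\<close>; hence a cell of \<open>A\<close> lies in all members
  that contain the neighbor, and in \<open>A\<close> as well.

  \<^emph>\<open>Upper bound.\<close> Enlarge each rectangle by one row below and one column to the right, so
  that a \<open>k \<times> l\<close> rectangle gets \<open>(k + 1) * (l + 1)\<close> cells. As \<open>k \<le> m - 1\<close> and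
  \<open>l \<le> n - 1\<close>, the enlarged rectangle still does not overlap itself on the torus, and rectangles
  that are not close have disjoint enlargements. Let \<open>a\<close> be the number of cells in the union of
  the enlargements. Induction over the nesting shows that a nonempty laminar family of \<open>N\<close>
  rectangles has \<open>2 * N + 2 \<le> a\<close>: a single rectangle has \<open>a \<ge> 4\<close>; separated parts with \<open>N\<^sub>1\<close>
  and \<open>N\<^sub>2\<close> members even give \<open>2 * (N\<^sub>1 + N\<^sub>2) + 4 \<le> a\<close>, which leaves room for a new
  rectangle around them; and a rectangle around a single largest one has an enlargement with at
  least two more cells (\<open>laminar_card_bound\<close>). Since \<open>a \<le> m * n\<close>, together with the
  whole torus there are at most \<open>m * n div 2\<close> islands.

  \<^emph>\<open>Lower bound.\<close> The induction shows how little may be wasted. Inside a box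
  whose enlargement is \<open>a \<times> b\<close> there is a laminar family of \<open>a * b div 2 - 1\<close> rectangles
  (\<open>ex_box_family\<close>): take the box itself, cut off a strip whose enlargement has width 2, hence
  even area, so that no half is lost to rounding, and recurse on both parts; when no side of the enlargement
  exceeds 3, a chain of nested boxes is large enough. The box of size
  \<open>(m - 1) \<times> (n - 1)\<close> and the whole torus together give \<open>m * n div 2\<close> islands.
\<close>

section \<open>Closeness on the torus\<close>

definition cyc_near :: "nat \<Rightarrow> nat \<Rightarrow> nat \<Rightarrow> bool" where
  "cyc_near m i j \<longleftrightarrow> (\<exists>a::int. \<bar>int i - int j - a * int m\<bar> \<le> 1)"

definition close :: "nat \<Rightarrow> nat \<Rightarrow> cell \<Rightarrow> cell \<Rightarrow> bool" where
  "close m n c d \<longleftrightarrow> cyc_near m (fst c) (fst d) \<and> cyc_near n (snd c) (snd d)"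

definition separated :: "nat \<Rightarrow> nat \<Rightarrow> cell set \<Rightarrow> cell set \<Rightarrow> bool" where
  "separated m n A B \<longleftrightarrow> (\<forall>c\<in>A. \<forall>d\<in>B. \<not> close m n c d)"

definition laminar :: "nat \<Rightarrow> nat \<Rightarrow> cell set set \<Rightarrow> bool" where
  "laminar m n F \<longleftrightarrow> (\<forall>A\<in>F. \<forall>B\<in>F. A \<subseteq> B \<or> B \<subseteq> A \<or> separated m n A B)"

lemma cyc_near_refl [simp]: "cyc_near m i i"
  unfolding cyc_near_def by (rule exI[of _ 0]) simp

lemma cyc_near_sym: "cyc_near m i j \<Longrightarrow> cyc_near m j i"
proof -
  assume "cyc_near m i j"
  then obtain a :: int where "\<bar>int i - int j - a * int m\<bar> \<le> 1"
    unfolding cyc_near_def by blast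
  then have "\<bar>int j - int i - (- a) * int m\<bar> \<le> 1" by simp
  then show ?thesis unfolding cyc_near_def by blast
qed

lemma close_refl [simp]: "close m n c c"
  by (simp add: close_def)

lemma close_sym: "close m n c d \<Longrightarrow> close m n d c"
  by (auto simp: close_def intro: cyc_near_sym)

lemma separated_sym: "separated m n A B \<Longrightarrow> separated m n B A"
  by (auto simp: separated_def dest: close_sym)

lemma separated_mono:
  "separated m n A B \<Longrightarrow> A' \<subseteq> A \<Longrightarrow> B' \<subseteq> B \<Longrightarrow> separated m n A' B'"
  unfolding separated_def by blast

lemma neighbor_iff_close: "neighbor m n c d \<longleftrightarrow> c \<noteq> d \<and> close m n c d"
  by (simp add: neighbor_iff close_def cyc_near_def)

lemma mem_neighbors_iff:
  "c \<in> neighbors m n R \<longleftrightarrow> c \<in> cells m n \<and> c \<notin> R \<and> (\<exists>d\<in>R. close m n c d)"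
  by (auto simp: neighbors_def neighbor_iff_close)

text \<open>Enlarging a set of cells down and to the right uses exactly such steps \<open>x\<close> and
  \<open>y\<close>; this is why enlargements of separated sets do not meet.\<close>

lemma cyc_near_if_mod_eq:
  fixes x y :: nat
  assumes "(i + x) mod m = (j + y) mod m" "x \<le> 1" "y \<le> 1"
  shows "cyc_near m i j"
proof -
  have "(int i + int x) mod int m = (int j + int y) mod int m"
    using assms(1) by (metis of_nat_add of_nat_mod)
  then obtain a where "int i + int x - (int j + int y) = int m * a"
    by (metis mod_eq_dvd_iff dvdE)
  then have "int i - int j - a * int m = int y - int x"
    by (simp add: algebra_simps)
  then show ?thesis
    unfolding cyc_near_def using assms(2,3) by (intro exI[of _ a]) linarith
qed

text \<open>Away from the last row the cyclic distance is the ordinary one.\<close>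

lemma cyc_near_planar:
  assumes "cyc_near m i j" "i < m - 1" "j < m - 1"
  shows "i \<le> j + 1 \<and> j \<le> i + 1"
proof -
  obtain a :: int where a: "\<bar>int i - int j - a * int m\<bar> \<le> 1"
    using assms(1) unfolding cyc_near_def by blast
  have "\<bar>a * int m\<bar> < 1 * int m"
    using a assms(2,3) by linarith
  then have "\<bar>a\<bar> * int m < 1 * int m"
    by (simp add: abs_mult)
  then have "\<bar>a\<bar> < 1"
    by (rule mult_right_less_imp_less) simp
  then show ?thesis using a by auto
qed

section \<open>Cyclic intervals and rectangles\<close>

lemma finite_cyclic_interval [simp]: "finite (cyclic_interval m s k)"
  by (simp add: cyclic_interval_def)

lemma cyclic_interval_0 [simp]: "cyclic_interval m s 0 = {}"
  by (simp add: cyclic_interval_def)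

lemma card_cyclic_interval:
  assumes "k \<le> m"
  shows "card (cyclic_interval m s k) = k"
proof -
  have "inj_on (\<lambda>i. (s + i) mod m) {..<k}"
  proof (rule inj_onI)
    fix x y assume "x \<in> {..<k}" "y \<in> {..<k}" and eq: "(s + x) mod m = (s + y) mod m"
    then have lt: "x < m" "y < m" using assms by auto
    have "(int s + int x) mod int m = (int s + int y) mod int m"
      using eq by (metis of_nat_add of_nat_mod)
    then have "int m dvd int x - int y"
      by (simp add: mod_eq_dvd_iff)
    moreover have "\<bar>int x - int y\<bar> < int m" using lt by linarith
    ultimately have "int x - int y = 0"
      using dvd_imp_le_int[of "int x - int y" "int m"] by fastforce
    then show "x = y" by simp
  qed
  then show ?thesis by (simp add: cyclic_interval_def card_image)
qed

lemma cyclic_interval_planar: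
  assumes "r + k \<le> m"
  shows "cyclic_interval m r k = {r..<r + k}"
proof -
  have "cyclic_interval m r k = (\<lambda>i. r + i) ` {..<k}"
    unfolding cyclic_interval_def by (rule image_cong) (use assms in auto)
  then show ?thesis by (simp add: lessThan_atLeast0 add.commute)
qed

lemma cyclic_interval_Suc:
  assumes "k > 0"
  shows "(\<lambda>(i, x). (i + x) mod m) ` (cyclic_interval m r k \<times> {..1}) = cyclic_interval m r (k + 1)"
proof -
  have "(\<lambda>(i, x). (i + x) mod m) ` (cyclic_interval m r k \<times> {..1}) =
        (\<lambda>i. (r + i) mod m) ` (\<lambda>(i, x). i + x) ` ({..<k} \<times> {..1})"
    by (force simp: cyclic_interval_def image_iff mod_add_left_eq add.assoc)
  also have "(\<lambda>(i, x). i + x) ` ({..<k} \<times> {..1}) = {..<k + 1}"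
  proof (intro equalityI subsetI)
    fix j assume j: "j \<in> {..<k + 1}"
    show "j \<in> (\<lambda>(i, x). i + x) ` ({..<k} \<times> {..1})"
    proof (cases "j < k")
      case True then show ?thesis by (auto intro: image_eqI[of _ _ "(j, 0)"])
    next
      case False
      with j assms show ?thesis by (auto intro: image_eqI[of _ _ "(k - 1, 1)"])
    qed
  qed auto
  finally show ?thesis by (simp add: cyclic_interval_def)
qed

lemma rectangle_subset_cells: "rectangle m n R \<Longrightarrow> R \<subseteq> cells m n"
  by (auto simp: rectangle_def cyclic_interval_def cells_def)

lemma finite_cells [simp]: "finite (cells m n)"
  by (simp add: cells_def)

lemma card_cells [simp]: "card (cells m n) = m * n"
  by (simp add: cells_def)

text \<open>Rectangles are connected, in the form in which it is used: one that meets \<open>R\<close> without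
  lying in \<open>R\<close> steps from \<open>R\<close> to a neighbor of \<open>R\<close>.\<close>

lemma rectangle_crosses_boundary:
  assumes S: "rectangle m n S" and "d \<in> S" "d \<in> R" and "\<not> S \<subseteq> R"
  shows "S \<inter> neighbors m n R \<noteq> {}"
proof (rule ccontr)
  assume none: "\<not> S \<inter> neighbors m n R \<noteq> {}"
  obtain r k s l where S_eq: "S = cyclic_interval m r k \<times> cyclic_interval n s l"
    using S unfolding rectangle_def by blast
  define f where "f = (\<lambda>x y. ((r + x) mod m, (s + y) mod n))"
  have f_in: "f x y \<in> S" if "x < k" "y < l" for x y
    using that by (auto simp: S_eq f_def cyclic_interval_def)
  have f_surj: "\<exists>x<k. \<exists>y<l. c = f x y" if "c \<in> S" for c
    using that by (auto simp: S_eq f_def cyclic_interval_def)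
  have closed: "c \<in> R \<longleftrightarrow> c' \<in> R" if "c \<in> S" "c' \<in> S" "close m n c c'" for c c'
    using that none rectangle_subset_cells[OF S] close_sym[OF that(3)] mem_neighbors_iff by blast
  have near: "cyc_near p (i mod p) (Suc i mod p)" for p i
    by (rule cyc_near_if_mod_eq[of _ 1 _ _ 0]) (simp_all add: mod_Suc_eq)
  have step_row: "f x y \<in> R \<longleftrightarrow> f (Suc x) y \<in> R" if "Suc x < k" "y < l" for x y
    using that by (intro closed f_in) (auto simp: f_def close_def near)
  have step_col: "f x y \<in> R \<longleftrightarrow> f x (Suc y) \<in> R" if "x < k" "Suc y < l" for x y
    using that by (intro closed f_in) (auto simp: f_def close_def near)
  have row: "f x y \<in> R \<longleftrightarrow> f 0 y \<in> R" if "x < k" "y < l" for x y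
    using that by (induction x) (auto simp: step_row)
  have col: "f 0 y \<in> R \<longleftrightarrow> f 0 0 \<in> R" if "0 < k" "y < l" for y
    using that by (induction y) (auto simp: step_col)
  have const: "c \<in> R \<longleftrightarrow> f 0 0 \<in> R" if c: "c \<in> S" for c
  proof -
    obtain x y where "x < k" "y < l" "c = f x y" using f_surj[OF c] by blast
    then show ?thesis using row[of x y] col[of y] by simp
  qed
  show False using const \<open>d \<in> S\<close> \<open>d \<in> R\<close> \<open>\<not> S \<subseteq> R\<close> by blast
qed

section \<open>The islands of a height function form a laminar family\<close>

lemma island_gt:
  assumes "island m n h R" "c \<in> R" "d \<in> neighbors m n R"
  shows "h d < h c"
proof -
  have fin: "finite R" "finite (neighbors m n R)"
    using finite_subset[OF island_subset_cells[OF assms(1)]] by (auto simp: neighbors_def)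
  have "h d \<le> Max (h ` neighbors m n R)" using fin assms(3) by simp
  also have "\<dots> < Min (h ` R)" using assms(1,3) by (auto simp: island_def)
  also have "\<dots> \<le> h c" using fin assms(2) by simp
  finally show ?thesis .
qed

lemma rectangle_meets_neighbors:
  assumes S: "rectangle m n S" and "c \<in> R" "d \<in> S" "close m n c d" and "\<not> S \<subseteq> R"
  shows "S \<inter> neighbors m n R \<noteq> {}"
proof (cases "d \<in> R")
  case True
  then show ?thesis using rectangle_crosses_boundary assms by blast
next
  case False
  then have "d \<in> neighbors m n R"
    using assms rectangle_subset_cells[OF S] close_sym[OF assms(4)] mem_neighbors_iff by blast
  then show ?thesis using \<open>d \<in> S\<close> by blast
qed

text \<open>If \<open>R\<close> and \<open>S\<close> are close but not nested, each contains a neighbor of the other, and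
  \<open>h\<close> would be larger on each of these two cells than on the other.\<close>

lemma islands_laminar:
  "laminar m n {R. island m n h R \<and> rectangle m n R}"
  unfolding laminar_def
proof (intro ballI)
  fix R S
  assume R: "R \<in> {R. island m n h R \<and> rectangle m n R}"
    and S: "S \<in> {R. island m n h R \<and> rectangle m n R}"
  show "R \<subseteq> S \<or> S \<subseteq> R \<or> separated m n R S"
  proof (rule ccontr)
    assume neg: "\<not> (R \<subseteq> S \<or> S \<subseteq> R \<or> separated m n R S)"
    then obtain c d where cd: "c \<in> R" "d \<in> S" "close m n c d"
      unfolding separated_def by blast
    obtain d' where d': "d' \<in> S" "d' \<in> neighbors m n R"
      using rectangle_meets_neighbors[OF _ cd(1,2,3)] S neg by blast
    obtain c' where c': "c' \<in> R" "c' \<in> neighbors m n S"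
      using rectangle_meets_neighbors[OF _ cd(2,1) close_sym[OF cd(3)]] R neg by blast
    have "h d' < h c'" using island_gt[of m n h R] R c' d' by blast
    moreover have "h c' < h d'" using island_gt[of m n h S] S c' d' by blast
    ultimately show False by simp
  qed
qed

section \<open>Enlarged rectangles and the upper bound\<close>

definition enlarge :: "nat \<Rightarrow> nat \<Rightarrow> cell set \<Rightarrow> cell set" where
  "enlarge m n R = (\<lambda>((i, j), (x, y)). ((i + x) mod m, (j + y) mod n)) ` (R \<times> ({..1} \<times> {..1}))"

lemma enlarge_mono: "R \<subseteq> S \<Longrightarrow> enlarge m n R \<subseteq> enlarge m n S"
  unfolding enlarge_def by (intro image_mono Sigma_mono) auto

lemma enlarge_subset_cells: "m > 0 \<Longrightarrow> n > 0 \<Longrightarrow> enlarge m n R \<subseteq> cells m n"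
  by (auto simp: enlarge_def cells_def)

lemma enlarge_disjoint:
  assumes "separated m n R S"
  shows "enlarge m n R \<inter> enlarge m n S = {}"
proof (rule ccontr)
  assume "enlarge m n R \<inter> enlarge m n S \<noteq> {}"
  then obtain i j i' j' x y x' y' where *:
    "(i, j) \<in> R" "(i', j') \<in> S" "x \<le> 1" "y \<le> 1" "x' \<le> 1" "y' \<le> 1"
    "(i + x) mod m = (i' + x') mod m" "(j + y) mod n = (j' + y') mod n"
    unfolding enlarge_def by (auto 0 3)
  have "cyc_near m i i'" using *(7,3,5) by (rule cyc_near_if_mod_eq)
  moreover have "cyc_near n j j'" using *(8,4,6) by (rule cyc_near_if_mod_eq)
  ultimately have "close m n (i, j) (i', j')" by (simp add: close_def)
  then show False using assms *(1,2) unfolding separated_def by blast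
qed

lemma enlarge_Times:
  "enlarge m n (I \<times> J) =
     (\<lambda>(i, x). (i + x) mod m) ` (I \<times> {..1}) \<times> (\<lambda>(j, y). (j + y) mod n) ` (J \<times> {..1})"
proof (intro equalityI subsetI)
  fix c assume "c \<in> (\<lambda>(i, x). (i + x) mod m) ` (I \<times> {..1}) \<times> (\<lambda>(j, y). (j + y) mod n) ` (J \<times> {..1})"
  then obtain i x j y where *: "i \<in> I" "x \<le> 1" "j \<in> J" "y \<le> 1"
    "c = ((i + x) mod m, (j + y) mod n)" by auto
  show "c \<in> enlarge m n (I \<times> J)"
    unfolding enlarge_def by (rule image_eqI[of _ _ "((i, j), (x, y))"]) (use * in auto)
qed (auto simp: enlarge_def)

lemma nonempty_rectangleE:
  assumes "rectangle m n R" "R \<noteq> {}" "m > 0" "n > 0"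
  obtains I J :: "nat set" where "R = I \<times> J" "I \<noteq> {}" "J \<noteq> {}" "finite I" "finite J"
    "card (enlarge m n R) = (card I + 1) * (card J + 1)"
proof -
  obtain r k s l where *: "k \<le> m - 1" "l \<le> n - 1"
    and R: "R = cyclic_interval m r k \<times> cyclic_interval n s l"
    using assms(1) unfolding rectangle_def by blast
  have pos: "k > 0" "l > 0" using R assms(2) by (auto intro!: gr0I)
  have "card (enlarge m n R) = (k + 1) * (l + 1)"
    using * assms(3,4) unfolding R enlarge_Times cyclic_interval_Suc[OF pos(1)]
      cyclic_interval_Suc[OF pos(2)]
    by (simp add: card_cartesian_product card_cyclic_interval)
  moreover have "card (cyclic_interval m r k) = k" "card (cyclic_interval n s l) = l"
    using * by (simp_all add: card_cyclic_interval)
  moreover have "cyclic_interval m r k \<noteq> {}" "cyclic_interval n s l \<noteq> {}"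
    using R assms(2) by auto
  ultimately show thesis using that R by simp
qed

lemma card_enlarge_ge_4:
  assumes "rectangle m n R" "R \<noteq> {}" "m > 0" "n > 0"
  shows "4 \<le> card (enlarge m n R)"
proof -
  obtain I J where IJ: "R = I \<times> J" "I \<noteq> {}" "J \<noteq> {}" "finite I" "finite J"
    "card (enlarge m n R) = (card I + 1) * (card J + 1)"
    by (rule nonempty_rectangleE[OF assms])
  have "2 \<le> card I + 1" "2 \<le> card J + 1"
    using IJ by (simp_all add: Suc_le_eq card_gt_0_iff)
  then have "2 * 2 \<le> (card I + 1) * (card J + 1)" by (rule mult_le_mono)
  then show ?thesis using IJ by simp
qed

text \<open>The smaller rectangle has fewer rows or fewer columns, and every line of an enlarged rectangle
  has at least two cells.\<close>

lemma card_enlarge_strict: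
  assumes R: "rectangle m n R" "R \<noteq> {}" and S: "rectangle m n S" and "R \<subset> S" and "m > 0" "n > 0"
  shows "card (enlarge m n R) + 2 \<le> card (enlarge m n S)"
proof -
  have "S \<noteq> {}" using assms by blast
  obtain I J where IJ: "R = I \<times> J" "I \<noteq> {}" "J \<noteq> {}" "finite I" "finite J"
    "card (enlarge m n R) = (card I + 1) * (card J + 1)"
    by (rule nonempty_rectangleE[OF R assms(5,6)])
  obtain I' J' where IJ': "S = I' \<times> J'" "I' \<noteq> {}" "J' \<noteq> {}" "finite I'" "finite J'"
    "card (enlarge m n S) = (card I' + 1) * (card J' + 1)"
    by (rule nonempty_rectangleE[OF S \<open>S \<noteq> {}\<close> assms(5,6)])
  have sub: "I \<subseteq> I'" "J \<subseteq> J'" using IJ IJ' \<open>R \<subset> S\<close> by blast+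
  have le: "card I \<le> card I'" "card J \<le> card J'"
    using sub IJ' by (simp_all add: card_mono)
  have pos: "1 \<le> card I" "1 \<le> card J"
    using IJ by (simp_all add: Suc_le_eq card_gt_0_iff)
  consider "I \<subset> I'" | "J \<subset> J'" using sub IJ IJ' \<open>R \<subset> S\<close> by blast
  then have "(card I + 1) * (card J + 1) + 2 \<le> (card I' + 1) * (card J' + 1)"
  proof cases
    case 1
    then have "card I + 2 \<le> card I' + 1" using IJ' psubset_card_mono[of I' I] by simp
    then have "(card I + 2) * (card J + 1) \<le> (card I' + 1) * (card J' + 1)"
      using le by (intro mult_le_mono) auto
    then show ?thesis using pos by simp
  next
    case 2
    then have "card J + 2 \<le> card J' + 1" using IJ' psubset_card_mono[of J' J] by simp
    then have "(card I + 1) * (card J + 2) \<le> (card I' + 1) * (card J' + 1)"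
      using le by (intro mult_le_mono) auto
    then show ?thesis using pos by simp
  qed
  then show ?thesis using IJ IJ' by simp
qed

text \<open>A family without a largest member splits into two nonempty parts whose unions of the sets
  \<open>E A\<close> are disjoint, so it gains the constant 2 twice. This stronger bound has to be part of the
  induction: it pays for a new member that contains several maximal ones, while \<open>strict\<close> pays
  for a new member that contains a single maximal one.\<close>

lemma laminar_card_bound:
  fixes E :: "'a set \<Rightarrow> 'b set"
  assumes "finite F" "F \<noteq> {}"
    and nested: "\<And>A B. A \<in> F \<Longrightarrow> B \<in> F \<Longrightarrow> A \<subseteq> B \<or> B \<subseteq> A \<or> E A \<inter> E B = {}"
    and mono: "\<And>A B. A \<in> F \<Longrightarrow> B \<in> F \<Longrightarrow> A \<subseteq> B \<Longrightarrow> E A \<subseteq> E B"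
    and fin: "\<And>A. A \<in> F \<Longrightarrow> finite (E A)"
    and four: "\<And>A. A \<in> F \<Longrightarrow> 4 \<le> card (E A)"
    and strict: "\<And>A B. A \<in> F \<Longrightarrow> B \<in> F \<Longrightarrow> A \<subset> B \<Longrightarrow> card (E A) + 2 \<le> card (E B)"
  shows "2 * card F + 2 \<le> card (\<Union>(E ` F)) \<and>
         ((\<exists>M\<in>F. \<forall>A\<in>F. A \<subseteq> M) \<or> 2 * card F + 4 \<le> card (\<Union>(E ` F)))"
  using assms
proof (induction F rule: finite_psubset_induct)
  case (psubset F)
  note nested = psubset.prems(2) and mono = psubset.prems(3) and fin = psubset.prems(4)
    and four = psubset.prems(5) and strict = psubset.prems(6)
  have IH: "2 * card G + 2 \<le> card (\<Union>(E ` G)) \<and>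
      ((\<exists>M\<in>G. \<forall>A\<in>G. A \<subseteq> M) \<or> 2 * card G + 4 \<le> card (\<Union>(E ` G)))"
    if "G \<subset> F" "G \<noteq> {}" for G
  proof -
    have sub: "A \<in> F" if "A \<in> G" for A using that \<open>G \<subset> F\<close> by blast
    show ?thesis
      by (rule psubset.IH[OF that]) (intro nested mono fin four strict sub; assumption)+
  qed
  have finF: "finite F" by fact
  have fin_UN: "finite (\<Union>(E ` G))" if "G \<subseteq> F" for G
    using that finF fin by (meson finite_UN finite_subset subsetD)
  obtain M where M: "M \<in> F" and max: "\<And>A. A \<in> F \<Longrightarrow> M \<subseteq> A \<Longrightarrow> A = M"
    using finite_has_maximal[OF finF \<open>F \<noteq> {}\<close>] by metis
  define D where "D = {A \<in> F. A \<subseteq> M}"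
  define Q where "Q = {A \<in> F. \<not> A \<subseteq> M}"
  have split: "F = D \<union> Q" "D \<inter> Q = {}" by (auto simp: D_def Q_def)
  have MD: "M \<in> D" using M by (simp add: D_def)
  show ?case
  proof (cases "Q = {}")
    case False
    have sub: "D \<subset> F" "Q \<subset> F" using split MD False by auto
    have disj: "\<Union>(E ` D) \<inter> \<Union>(E ` Q) = {}"
    proof -
      have "E A \<inter> E B = {}" if A: "A \<in> D" and B: "B \<in> Q" for A B
      proof -
        have "B \<in> F" "\<not> B \<subseteq> M" using B by (auto simp: Q_def)
        then have "E M \<inter> E B = {}" using nested[OF M \<open>B \<in> F\<close>] max[of B] by blast
        moreover have "E A \<subseteq> E M" using A M mono by (auto simp: D_def)
        ultimately show ?thesis by blast
      qed
      then show ?thesis by blast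
    qed
    have "card (\<Union>(E ` F)) = card (\<Union>(E ` D) \<union> \<Union>(E ` Q))"
      using split(1) by (simp add: Union_Un_distrib image_Un)
    also have "\<dots> = card (\<Union>(E ` D)) + card (\<Union>(E ` Q))"
      using sub by (intro card_Un_disjoint fin_UN disj) auto
    finally have "card (\<Union>(E ` F)) = card (\<Union>(E ` D)) + card (\<Union>(E ` Q))" .
    moreover have "card F = card D + card Q"
      using split finF by (simp add: card_Un_disjoint)
    moreover have "2 * card D + 2 \<le> card (\<Union>(E ` D))" using IH[OF sub(1)] MD by blast
    moreover have "2 * card Q + 2 \<le> card (\<Union>(E ` Q))" using IH[OF sub(2)] False by blast
    ultimately show ?thesis by linarith
  next
    case True
    then have top: "A \<subseteq> M" if "A \<in> F" for A using that by (auto simp: Q_def)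
    have UN_eq: "\<Union>(E ` F) = E M" using top mono M by blast
    define G where "G = F - {M}"
    have GF: "G \<subset> F" using M by (auto simp: G_def)
    have cardF: "card F = card G + 1" unfolding G_def using card.remove[OF finF M] by presburger
    have "2 * card F + 2 \<le> card (E M)"
    proof (cases "G = {}")
      case True
      then show ?thesis using cardF four[OF M] by simp
    next
      case False
      from IH[OF GF False] have base: "2 * card G + 2 \<le> card (\<Union>(E ` G))"
        and alt: "(\<exists>M'\<in>G. \<forall>A\<in>G. A \<subseteq> M') \<or> 2 * card G + 4 \<le> card (\<Union>(E ` G))" by blast+
      from alt show ?thesis
      proof
        assume "\<exists>M'\<in>G. \<forall>A\<in>G. A \<subseteq> M'"
        then obtain M' where M': "M' \<in> G" "\<And>A. A \<in> G \<Longrightarrow> A \<subseteq> M'" by blast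
        have "M' \<in> F" "M' \<subset> M" using M'(1) top by (auto simp: G_def)
        then have "card (E M') + 2 \<le> card (E M)" using strict M by blast
        moreover have "\<Union>(E ` G) \<subseteq> E M'" using M' mono GF \<open>M' \<in> F\<close> by blast
        then have "card (\<Union>(E ` G)) \<le> card (E M')" using fin \<open>M' \<in> F\<close> card_mono by blast
        ultimately show ?thesis using base cardF by linarith
      next
        assume "2 * card G + 4 \<le> card (\<Union>(E ` G))"
        moreover have "\<Union>(E ` G) \<subseteq> E M" using UN_eq GF by blast
        then have "card (\<Union>(E ` G)) \<le> card (E M)" using fin M card_mono by blast
        ultimately show ?thesis using cardF by linarith
      qed
    qed
    moreover have "\<exists>M\<in>F. \<forall>A\<in>F. A \<subseteq> M" using M top by blast
    ultimately show ?thesis using UN_eq by simp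
  qed
qed

lemma card_islands_le:
  assumes "m \<ge> 2" "n \<ge> 2"
  shows "card (islands m n h) \<le> m * n div 2"
proof -
  define F where "F = {R. island m n h R \<and> rectangle m n R}"
  have pos: "m > 0" "n > 0" using assms by auto
  have F_sub: "F \<subseteq> islands m n h" by (auto simp: F_def islands_def)
  have finF: "finite F" by (rule finite_subset[OF F_sub finite_islands])
  have FE: "rectangle m n R" "R \<noteq> {}" if "R \<in> F" for R
    using that by (auto simp: F_def island_def)
  have "islands m n h \<subseteq> insert (cells m n) F"
    by (auto simp: islands_def F_def island_def)
  then have "card (islands m n h) \<le> card (insert (cells m n) F)"
    using finF by (intro card_mono) auto
  also have "\<dots> \<le> card F + 1" using finF by (simp add: card_insert_if)
  finally have le: "card (islands m n h) \<le> card F + 1" .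
  have "2 * card F + 2 \<le> m * n"
  proof (cases "F = {}")
    case True
    have "2 * 2 \<le> m * n" using assms by (rule mult_le_mono)
    then show ?thesis using True by simp
  next
    case False
    have lam: "laminar m n F" unfolding F_def by (rule islands_laminar)
    have "2 * card F + 2 \<le> card (\<Union>(enlarge m n ` F))"
    proof (rule conjunct1[OF laminar_card_bound[OF finF False]])
      show "A \<subseteq> B \<or> B \<subseteq> A \<or> enlarge m n A \<inter> enlarge m n B = {}" if "A \<in> F" "B \<in> F" for A B
        using lam that enlarge_disjoint unfolding laminar_def by meson
      show "finite (enlarge m n A)" for A
        by (rule finite_subset[OF enlarge_subset_cells[OF pos] finite_cells])
      show "enlarge m n A \<subseteq> enlarge m n B" if "A \<subseteq> B" for A B
        using that by (rule enlarge_mono)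
      show "4 \<le> card (enlarge m n A)" if "A \<in> F" for A
        using FE[OF that] pos by (rule card_enlarge_ge_4)
      show "card (enlarge m n A) + 2 \<le> card (enlarge m n B)" if "A \<in> F" "B \<in> F" "A \<subset> B" for A B
        using FE[OF that(1)] FE(1)[OF that(2)] that(3) pos by (rule card_enlarge_strict)
    qed
    also have "\<dots> \<le> card (cells m n)"
      using enlarge_subset_cells[OF pos] by (intro card_mono) auto
    finally show ?thesis by simp
  qed
  then show ?thesis using le by linarith
qed

section \<open>Heights from laminar families\<close>

lemma laminar_depth_island:
  assumes "finite F" "laminar m n F" and A: "A \<in> F" "A \<noteq> {}" "rectangle m n A"
  shows "island m n (\<lambda>c. real (card {S \<in> F. c \<in> S})) A"
proof -
  let ?h = "\<lambda>c. real (card {S \<in> F. c \<in> S})"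
  have less: "?h d < ?h c" if c: "c \<in> A" and d: "d \<in> neighbors m n A" for c d
  proof -
    obtain c' where c': "c' \<in> A" "close m n d c'" "d \<notin> A"
      using d by (auto simp: mem_neighbors_iff)
    have "A \<subseteq> S" if "S \<in> F" "d \<in> S" for S
      using assms(2) A(1) that c' close_sym[OF c'(2)] unfolding laminar_def separated_def by blast
    then have "{S \<in> F. d \<in> S} \<subset> {S \<in> F. c \<in> S}" using c A(1) c'(3) by blast
    then show ?thesis using assms(1) by (simp add: psubset_card_mono)
  qed
  have "finite A" "finite (neighbors m n A)"
    using finite_subset[OF rectangle_subset_cells[OF A(3)]] by (auto simp: neighbors_def)
  then show ?thesis using A less by (cases "neighbors m n A = {}") (simp_all add: island_def)
qed

lemma island_cells:
  assumes "m > 0" "n > 0"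
  shows "island m n h (cells m n)"
proof -
  have "neighbors m n (cells m n) = {}" by (auto simp: neighbors_def)
  moreover have "cells m n \<noteq> {}" using assms by (auto simp: cells_def)
  ultimately show ?thesis by (simp add: island_def)
qed

section \<open>A large laminar family and the lower bound\<close>

text \<open>The sizes \<open>a\<close> and \<open>b\<close> are those of the enlarged box, so that \<open>r + a \<le> m\<close> and
  \<open>s + b \<le> n\<close> say that the box leaves out the last row and the last column of the torus.\<close>

definition box :: "nat \<Rightarrow> nat \<Rightarrow> nat \<Rightarrow> nat \<Rightarrow> cell set" where
  "box r a s b = {r..<r + a - 1} \<times> {s..<s + b - 1}"

lemma rectangle_box:
  assumes "a \<ge> 2" "b \<ge> 2" "r + a \<le> m" "s + b \<le> n"
  shows "rectangle m n (box r a s b)"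
  unfolding rectangle_def
proof (intro exI conjI)
  show "box r a s b = cyclic_interval m r (a - 1) \<times> cyclic_interval n s (b - 1)"
    using assms by (simp add: box_def cyclic_interval_planar)
qed (use assms in auto)

definition rect_family :: "nat \<Rightarrow> nat \<Rightarrow> cell set \<Rightarrow> cell set set \<Rightarrow> bool" where
  "rect_family m n B F \<longleftrightarrow> finite F \<and> laminar m n F \<and>
     (\<forall>A\<in>F. A \<noteq> {} \<and> A \<subseteq> B \<and> rectangle m n A)"

lemma rect_family_insert:
  assumes "rect_family m n B' F" "B' \<subset> B" "rectangle m n B"
  shows "rect_family m n B (insert B F)" "card (insert B F) = card F + 1"
proof -
  have F: "finite F" "laminar m n F" "\<And>A. A \<in> F \<Longrightarrow> A \<noteq> {} \<and> A \<subseteq> B' \<and> rectangle m n A"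
    using assms(1) by (auto simp: rect_family_def)
  have sub: "A \<subseteq> B" "A \<noteq> B" if "A \<in> F" for A
    using F(3)[OF that] assms(2) by blast+
  have "laminar m n (insert B F)"
    using F(2) sub(1) unfolding laminar_def by blast
  then show "rect_family m n B (insert B F)"
    using F(1,3) sub(1) assms(2,3) unfolding rect_family_def by blast
  show "card (insert B F) = card F + 1"
    using F(1) sub(2)[of B] by (auto simp: card_insert_if)
qed

lemma rect_family_Un:
  assumes "rect_family m n B\<^sub>1 F\<^sub>1" "rect_family m n B\<^sub>2 F\<^sub>2" "separated m n B\<^sub>1 B\<^sub>2"
  shows "rect_family m n (B\<^sub>1 \<union> B\<^sub>2) (F\<^sub>1 \<union> F\<^sub>2)" "card (F\<^sub>1 \<union> F\<^sub>2) = card F\<^sub>1 + card F\<^sub>2"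
proof -
  have sep: "separated m n A\<^sub>1 A\<^sub>2" "separated m n A\<^sub>2 A\<^sub>1" if "A\<^sub>1 \<in> F\<^sub>1" "A\<^sub>2 \<in> F\<^sub>2" for A\<^sub>1 A\<^sub>2
    using that assms separated_mono[OF assms(3)] separated_sym
    by (auto simp: rect_family_def)
  show "rect_family m n (B\<^sub>1 \<union> B\<^sub>2) (F\<^sub>1 \<union> F\<^sub>2)"
  proof -
    have "laminar m n F\<^sub>1" "laminar m n F\<^sub>2" using assms(1,2) by (simp_all add: rect_family_def)
    then have "laminar m n (F\<^sub>1 \<union> F\<^sub>2)" using sep unfolding laminar_def by (meson UnE)
    then show ?thesis using assms(1,2) unfolding rect_family_def by blast
  qed
  have "F\<^sub>1 \<inter> F\<^sub>2 = {}"
  proof -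
    have "A \<notin> F\<^sub>2" if "A \<in> F\<^sub>1" for A
    proof -
      have "A \<noteq> {}" using assms(1) that by (simp add: rect_family_def)
      then show ?thesis using sep(1)[OF that, of A] close_refl unfolding separated_def by blast
    qed
    then show ?thesis by blast
  qed
  then show "card (F\<^sub>1 \<union> F\<^sub>2) = card F\<^sub>1 + card F\<^sub>2"
    using assms(1,2) by (simp add: rect_family_def card_Un_disjoint)
qed

lemma box_split_rows:
  assumes "a \<ge> 4" "b \<ge> 2" "r + a \<le> m" "s + b \<le> n"
  shows "separated m n (box r 2 s b) (box (r + 2) (a - 2) s b)"
    and "box r 2 s b \<union> box (r + 2) (a - 2) s b \<subset> box r a s b"
proof -
  show "separated m n (box r 2 s b) (box (r + 2) (a - 2) s b)"
    using assms by (auto simp: separated_def box_def close_def dest!: cyc_near_planar)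
  have "(r + 1, s) \<in> box r a s b" "(r + 1, s) \<notin> box r 2 s b \<union> box (r + 2) (a - 2) s b"
    using assms by (auto simp: box_def)
  moreover have "box r 2 s b \<union> box (r + 2) (a - 2) s b \<subseteq> box r a s b"
    using assms by (auto simp: box_def)
  ultimately show "box r 2 s b \<union> box (r + 2) (a - 2) s b \<subset> box r a s b" by blast
qed

lemma box_split_columns:
  assumes "a \<ge> 2" "b \<ge> 4" "r + a \<le> m" "s + b \<le> n"
  shows "separated m n (box r a s 2) (box r a (s + 2) (b - 2))"
    and "box r a s 2 \<union> box r a (s + 2) (b - 2) \<subset> box r a s b"
proof -
  show "separated m n (box r a s 2) (box r a (s + 2) (b - 2))"
    using assms by (auto simp: separated_def box_def close_def dest!: cyc_near_planar)
  have "(r, s + 1) \<in> box r a s b" "(r, s + 1) \<notin> box r a s 2 \<union> box r a (s + 2) (b - 2)"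
    using assms by (auto simp: box_def)
  moreover have "box r a s 2 \<union> box r a (s + 2) (b - 2) \<subseteq> box r a s b"
    using assms by (auto simp: box_def)
  ultimately show "box r a s 2 \<union> box r a (s + 2) (b - 2) \<subset> box r a s b" by blast
qed

text \<open>A side of enlarged length at least 4 is cut as \<open>2 + (a - 2)\<close>, at the cost of one row or
  column between the parts. For sides 2 and 3 a chain of nested boxes is already large enough.\<close>

lemma ex_box_family:
  assumes "a \<ge> 2" "b \<ge> 2" "r + a \<le> m" "s + b \<le> n"
  shows "\<exists>F. rect_family m n (box r a s b) F \<and> card F = a * b div 2 - 1"
  using assms
proof (induction "a + b" arbitrary: a b r s rule: less_induct)
  case (less a b r s)
  have rect: "rectangle m n (box r a s b)" using less.prems by (rule rectangle_box)
  \<comment> \<open>Both cuts end in the same way: the box itself makes up for one of the two subtracted ones.\<close>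
  have join: ?case
    if "rect_family m n B\<^sub>1 F\<^sub>1" "rect_family m n B\<^sub>2 F\<^sub>2" "separated m n B\<^sub>1 B\<^sub>2"
      "B\<^sub>1 \<union> B\<^sub>2 \<subset> box r a s b" "card F\<^sub>1 + card F\<^sub>2 + 1 = a * b div 2 - 1" for B\<^sub>1 B\<^sub>2 F\<^sub>1 F\<^sub>2
    using rect_family_insert[OF rect_family_Un(1)[OF that(1-3)] that(4) rect]
      rect_family_Un(2)[OF that(1-3)] that(5) by metis
  have nest: ?case
    if "rect_family m n B' F" "B' \<subset> box r a s b" "card F + 1 = a * b div 2 - 1" for B' F
    using rect_family_insert[OF that(1,2) rect] that(3) by metis
  consider "a \<ge> 4" | "b \<ge> 4" | "a = 3" "b \<le> 3" | "a = 2" "b = 3" | "a = 2" "b = 2"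
    using less.prems by linarith
  then show ?case
  proof cases
    case 1
    obtain F\<^sub>1 where F1: "rect_family m n (box r 2 s b) F\<^sub>1" "card F\<^sub>1 = 2 * b div 2 - 1"
      using less.hyps[of 2 b r s] less.prems 1 by auto
    have "r + 2 + (a - 2) \<le> m" "2 \<le> a - 2" using 1 less.prems by linarith+
    then obtain F\<^sub>2 where F2: "rect_family m n (box (r + 2) (a - 2) s b) F\<^sub>2"
        "card F\<^sub>2 = (a - 2) * b div 2 - 1"
      using less.hyps[of "a - 2" b "r + 2" s] less.prems 1 by (auto simp del: add_2_eq_Suc')
    show ?thesis
    proof (rule join[OF F1(1) F2(1) box_split_rows])
      have "2 * 2 \<le> (a - 2) * b" using 1 less.prems by (intro mult_le_mono) auto
      then have "2 \<le> (a - 2) * b div 2" by linarith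
      moreover have "a = (a - 2) + 2" using 1 by simp
      then have "a * b = (a - 2) * b + 2 * b" by (metis distrib_right)
      ultimately show "card F\<^sub>1 + card F\<^sub>2 + 1 = a * b div 2 - 1"
        using F1(2) F2(2) less.prems by simp linarith
    qed (use 1 less.prems in auto)
  next
    case 2
    obtain F\<^sub>1 where F1: "rect_family m n (box r a s 2) F\<^sub>1" "card F\<^sub>1 = a * 2 div 2 - 1"
      using less.hyps[of a 2 r s] less.prems 2 by auto
    have "s + 2 + (b - 2) \<le> n" "2 \<le> b - 2" using 2 less.prems by linarith+
    then obtain F\<^sub>2 where F2: "rect_family m n (box r a (s + 2) (b - 2)) F\<^sub>2"
        "card F\<^sub>2 = a * (b - 2) div 2 - 1"
      using less.hyps[of a "b - 2" r "s + 2"] less.prems 2 by (auto simp del: add_2_eq_Suc')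
    show ?thesis
    proof (rule join[OF F1(1) F2(1) box_split_columns])
      have "2 * 2 \<le> a * (b - 2)" using 2 less.prems by (intro mult_le_mono) auto
      then have "2 \<le> a * (b - 2) div 2" by linarith
      moreover have "b = (b - 2) + 2" using 2 by simp
      then have "a * b = a * (b - 2) + a * 2" by (metis distrib_left)
      ultimately show "card F\<^sub>1 + card F\<^sub>2 + 1 = a * b div 2 - 1"
        using F1(2) F2(2) less.prems by simp linarith
    qed (use 2 less.prems in auto)
  next
    case 3
    obtain F where F: "rect_family m n (box r 2 s b) F" "card F = 2 * b div 2 - 1"
      using less.hyps[of 2 b r s] less.prems 3 by auto
    have "(r + 1, s) \<in> box r a s b - box r 2 s b" using 3 less.prems by (auto simp: box_def)
    moreover have "box r 2 s b \<subseteq> box r a s b" using 3 by (auto simp: box_def)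
    moreover have "b = 2 \<or> b = 3" using 3 less.prems by linarith
    ultimately show ?thesis using 3 F(2) by (intro nest[OF F(1)]) auto
  next
    case 4
    obtain F where F: "rect_family m n (box r 2 s 2) F" "card F = 2 * 2 div 2 - 1"
      using less.hyps[of 2 2 r s] less.prems 4 by auto
    have "(r, s + 1) \<in> box r a s b - box r 2 s 2" using 4 by (auto simp: box_def)
    moreover have "box r 2 s 2 \<subseteq> box r a s b" using 4 by (auto simp: box_def)
    ultimately show ?thesis using 4 F(2) by (intro nest[OF F(1)]) auto
  next
    case 5
    have "rect_family m n {} {}" by (simp add: rect_family_def laminar_def)
    moreover have "(r, s) \<in> box r a s b" using 5 by (auto simp: box_def)
    ultimately show ?thesis using 5 by (intro nest[of "{}" "{}"]) auto
  qed
qed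

lemma ex_card_islands_ge:
  assumes "m \<ge> 2" "n \<ge> 2"
  shows "\<exists>h. m * n div 2 \<le> card (islands m n h)"
proof -
  obtain F where F: "rect_family m n (box 0 m 0 n) F" "card F = m * n div 2 - 1"
    using ex_box_family[of m n 0 m 0 n] assms by auto
  define h where "h = (\<lambda>c. real (card {S \<in> F. c \<in> S}))"
  have "insert (cells m n) F \<subseteq> islands m n h"
    using F(1) assms laminar_depth_island island_cells
    by (auto simp: islands_def h_def rect_family_def)
  then have "card (insert (cells m n) F) \<le> card (islands m n h)"
    by (intro card_mono finite_islands)
  moreover have "cells m n \<notin> F"
  proof
    assume "cells m n \<in> F"
    then have "cells m n \<subseteq> box 0 m 0 n" using F(1) by (simp add: rect_family_def)
    moreover have "(m - 1, n - 1) \<in> cells m n - box 0 m 0 n"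
      using assms by (auto simp: cells_def box_def)
    ultimately show False by blast
  qed
  moreover have "2 * 2 \<le> m * n" using assms by (rule mult_le_mono)
  ultimately show ?thesis using F by (intro exI[of _ h]) (auto simp: rect_family_def)
qed

theorem theorem9:
  fixes m n :: nat
  assumes "m \<ge> 2" and "n \<ge> 2"
  shows "max_islands m n = (m * n) div 2"
  unfolding max_islands_def
proof (rule Max_eqI[OF finite_island_counts])
  show "k \<le> m * n div 2" if "k \<in> range (\<lambda>h :: cell \<Rightarrow> real. card (islands m n h))" for k
    using that card_islands_le[OF assms] by blast
  obtain h where "m * n div 2 \<le> card (islands m n h)"
    using ex_card_islands_ge[OF assms] by blast
  then have "card (islands m n h) = m * n div 2"
    using card_islands_le[OF assms] by (simp add: le_antisym)
  then show "m * n div 2 \<in> range (\<lambda>h :: cell \<Rightarrow> real. card (islands m n h))"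
    by (metis rangeI)
qed

end
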